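(* Let $F$ be a field of characteristic $\neq 2$. The variety $\mathsf{WN}^{(2)}$ of weakly Novikov metabelian algebras over $F$ and the variety $\mathsf{N}^{(2)}$ of Novikov metabelian algebras over $F$ are both left nilpotent of exact index $5$.
   Context: Algebras are nonassociative (not necessarily associative) over $F$; $(x,y,z)=(xy)z-x(yz)$. $\mathsf{WN}^{(2)}$ is the variety of $F$-algebras defined by the identities $(x,y,z)=(x,z,y)$ (right symmetry), $x(y,z,t)=(y,z,xt)$ (weakly Novikov identity) and $(xy)(zt)=0$ (metabelian identity). $\mathsf{N}^{(2)}$ is the subvariety of $\mathsf{WN}^{(2)}$ distinguished by the additional identity $x(yz)=y(xz)$ (left commutativity). For an algebra $A$ put $A^{\langle 1\rangle}=A$ and $A^{\langle n+1\rangle}=A\cdot A^{\langle n\rangle}$ (the linear span of all products $ab$ with $a\in A$, $b\in A^{\langle n\rangle}$). A variety is left nilpotent of exact index $n$ if $A^{\langle n\rangle}=0$ for every algebra $A$ in the variety and $n$ is the least positive integer with this property. *)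

theory Defs
  imports Complex_Main "HOL-Computational_Algebra.Computational_Algebra" "HOL-Library.Function_Algebras"
begin

locale nonassoc_algebra =
  vector_space scale
  for scale :: "'f::field \<Rightarrow> 'a::ab_group_add \<Rightarrow> 'a" +
  fixes mul :: "'a \<Rightarrow> 'a \<Rightarrow> 'a"  (infixl "\<odot>" 70)
  assumes linear_mul_left: "Vector_Spaces.linear scale scale (\<lambda>x. x \<odot> y)"
    and linear_mul_right: "Vector_Spaces.linear scale scale (\<lambda>y. x \<odot> y)"

definition associator :: "('a::ab_group_add \<Rightarrow> 'a \<Rightarrow> 'a) \<Rightarrow> 'a \<Rightarrow> 'a \<Rightarrow> 'a \<Rightarrow> 'a" where
  "associator mul x y z = mul (mul x y) z - mul x (mul y z)"

locale weakly_novikov_metabelian = nonassoc_algebra scale mul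
  for scale :: "'f::field \<Rightarrow> 'a::ab_group_add \<Rightarrow> 'a"
    and mul :: "'a \<Rightarrow> 'a \<Rightarrow> 'a"  (infixl "\<odot>" 70) +
  assumes right_symmetric: "associator mul x y z = associator mul x z y"
    and weakly_novikov: "x \<odot> associator mul y z t = associator mul y z (x \<odot> t)"
    and metabelian: "(x \<odot> y) \<odot> (z \<odot> t) = 0"

locale novikov_metabelian = weakly_novikov_metabelian scale mul
  for scale :: "'f::field \<Rightarrow> 'a::ab_group_add \<Rightarrow> 'a"
    and mul :: "'a \<Rightarrow> 'a \<Rightarrow> 'a"  (infixl "\<odot>" 70) +
  assumes left_commutative: "x \<odot> (y \<odot> z) = y \<odot> (x \<odot> z)"

(* Powers are indexed from 1; the value at 0 is a dummy and is never used below. *)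
fun left_power ::
  "('f::field \<Rightarrow> 'a::ab_group_add \<Rightarrow> 'a) \<Rightarrow> ('a \<Rightarrow> 'a \<Rightarrow> 'a) \<Rightarrow> nat \<Rightarrow> 'a set" where
  "left_power scale mul 0 = UNIV"
| "left_power scale mul (Suc 0) = UNIV"
| "left_power scale mul (Suc (Suc n)) =
     module.span scale {mul a b | a b. b \<in> left_power scale mul (Suc n)}"

(* The algebras of a variety whose underlying vector space is the whole type 'a. *)
type_synonym ('f, 'a) algebra_class = "('f \<Rightarrow> 'a \<Rightarrow> 'a) \<Rightarrow> ('a \<Rightarrow> 'a \<Rightarrow> 'a) \<Rightarrow> bool"

definition left_nilpotent_class ::
  "('f::field, 'a::ab_group_add) algebra_class \<Rightarrow> nat \<Rightarrow> bool" where
  "left_nilpotent_class V n \<longleftrightarrow> (\<forall>scale mul. V scale mul \<longrightarrow> left_power scale mul n = {0})"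

(* A variety is a proper class, and a HOL formula cannot quantify over the types carrying its
   algebras. So V and W are to be instantiated by the same variety on two types: V on an
   arbitrary type 'a, so that a theorem polymorphic in 'a asserts nilpotency of every algebra of
   the variety, and W on the type of sequences over 'f. Minimality is tested on W only: an
   algebra of the variety with nonzero m-th left power has a finitely generated subalgebra with
   this property, which has countable dimension, and its direct sum with a suitable algebra with
   zero multiplication lives on a space isomorphic to 'f-valued sequences. *)
definition left_nilpotent_of_exact_index ::
  "('f::field, 'a::ab_group_add) algebra_class \<Rightarrow> ('f, nat \<Rightarrow> 'f) algebra_class \<Rightarrow> nat \<Rightarrow> bool"
where
  "left_nilpotent_of_exact_index V W n \<longleftrightarrow>
     0 < n \<and> left_nilpotent_class V n \<and> (\<forall>m. 0 < m \<and> left_nilpotent_class W m \<longrightarrow> n \<le> m)"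

end

theory Submission
  imports Defs
begin

text \<open>
  Upper bound. Let \<open>w\<close> be a linear combination of products. The metabelian identity gives
  \<open>(y, t, w) = - y(tw)\<close> and \<open>(y, w, xt) = (yw)(xt) - y(w(xt)) = 0\<close>. By right symmetry and the weakly
  Novikov identity, \<open>- x(y(tw)) = x(y, t, w) = x(y, w, t) = (y, w, xt) = 0\<close>, so the fifth left power
  vanishes (\<open>left_mul_thrice_eq_0\<close>).

  Lower bound. If \<open>D\<close> is a derivation of a commutative associative algebra, then the product
  \<open>D(a) b\<close> is left commutative, right symmetric and weakly Novikov. Take the differential polynomials
  in one variable \<open>x\<close> with this product, and in them the subalgebra spanned by the monomials of
  degree \<open>n \<ge> 1\<close> with \<open>n - 1\<close> derivatives. Discard the degrees above 4 and identify
  \<open>x\<^sup>2x'' = - xx'\<^sup>2\<close>, \<open>x\<^sup>2x'x'' = - xx'\<^sup>3\<close>, \<open>x\<^sup>3x''' = 3xx'\<^sup>3\<close>. The result is a metabelian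
  algebra with basis \<open>f\<^sub>0 = x\<close>, \<open>f\<^sub>1 = xx'\<close>, \<open>f\<^sub>2 = xx'\<^sup>2\<close>, \<open>f\<^sub>3 = xx'\<^sup>3\<close> and nonzero products
  \<open>f\<^sub>0f\<^sub>0 = f\<^sub>1\<close>, \<open>f\<^sub>0f\<^sub>1 = f\<^sub>2\<close>, \<open>f\<^sub>0f\<^sub>2 = f\<^sub>3\<close>, \<open>f\<^sub>2f\<^sub>0 = - f\<^sub>3\<close>. In it \<open>f\<^sub>0(f\<^sub>0(f\<^sub>0f\<^sub>0)) = f\<^sub>3\<close>, so its fourth
  left power is nonzero (\<open>novikov_metabelian_seq\<close>, \<open>unit_seq_in_left_power\<close>).
\<close>

context nonassoc_algebra
begin

lemma mul_zero_right [simp]: "x \<odot> 0 = 0"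
  using linear_mul_right by (rule module_hom.zero[OF Vector_Spaces.linear.axioms(3)])

lemma linear_mul_twice: "Vector_Spaces.linear scale scale (\<lambda>z. x \<odot> (y \<odot> z))"
  using Vector_Spaces.linear_compose[OF linear_mul_right[of y] linear_mul_right[of x]]
  by (simp add: o_def)

lemma linear_mul_thrice: "Vector_Spaces.linear scale scale (\<lambda>z. t \<odot> (x \<odot> (y \<odot> z)))"
  using Vector_Spaces.linear_compose[OF linear_mul_twice[of x y] linear_mul_right[of t]]
  by (simp add: o_def)

lemma linear_eq_0_on_left_power:
  assumes lin: "Vector_Spaces.linear scale scale f"
    and zero: "\<And>a b. b \<in> left_power scale mul (Suc n) \<Longrightarrow> f (a \<odot> b) = 0"
    and z: "z \<in> left_power scale mul (Suc (Suc n))"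
  shows "f z = 0"
  using module_hom.eq_0_on_span
    [OF Vector_Spaces.linear.axioms(3)[OF lin], of "{a \<odot> b | a b. b \<in> left_power scale mul (Suc n)}" z] z zero
  by auto

end

context weakly_novikov_metabelian
begin

lemma left_mul_thrice_eq_0: "x \<odot> (y \<odot> (t \<odot> (a \<odot> b))) = 0"
proof -
  let ?w = "a \<odot> b"
  have "x \<odot> associator mul y t ?w = associator mul y ?w (x \<odot> t)"
    using right_symmetric[of y t ?w] weakly_novikov[of x y ?w t] by simp
  also have "\<dots> = 0"
    by (simp add: associator_def metabelian)
  finally have "x \<odot> (- (y \<odot> (t \<odot> ?w))) = 0"
    by (simp add: associator_def metabelian)
  then show ?thesis
    by (simp add: module_hom.neg[OF Vector_Spaces.linear.axioms(3)[OF linear_mul_right]])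
qed

lemma left_power_5: "left_power scale mul 5 = {0}"
proof -
  have 1: "x \<odot> (y \<odot> (t \<odot> z)) = 0" if "z \<in> left_power scale mul (Suc (Suc 0))" for x y t z
    using linear_mul_thrice _ that by (rule linear_eq_0_on_left_power) (rule left_mul_thrice_eq_0)
  have 2: "x \<odot> (y \<odot> z) = 0" if "z \<in> left_power scale mul (Suc (Suc (Suc 0)))" for x y z
    using linear_mul_twice _ that by (rule linear_eq_0_on_left_power) (rule 1)
  have 3: "x \<odot> z = 0" if "z \<in> left_power scale mul (Suc (Suc (Suc (Suc 0))))" for x z
    using linear_mul_right _ that by (rule linear_eq_0_on_left_power) (rule 2)
  have "z = 0" if "z \<in> left_power scale mul (Suc (Suc (Suc (Suc (Suc 0)))))" for z
    using linear_ident _ that by (rule linear_eq_0_on_left_power) (rule 3)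
  moreover have "0 \<in> left_power scale mul (Suc (Suc (Suc (Suc (Suc 0)))))"
    by (simp add: span_zero)
  ultimately show ?thesis
    by (auto simp: eval_nat_numeral simp del: left_power.simps)
qed

end

text \<open>
  The four-dimensional algebra described above, with a sequence \<open>a\<close> read as
  \<open>a 0 f\<^sub>0 + a 1 f\<^sub>1 + a 2 f\<^sub>2 + a 3 f\<^sub>3\<close>; the remaining entries form a direct summand with zero
  multiplication.
\<close>

definition seq_mul :: "(nat \<Rightarrow> 'f::field) \<Rightarrow> (nat \<Rightarrow> 'f) \<Rightarrow> nat \<Rightarrow> 'f" where
  "seq_mul a b = (\<lambda>n. if n = 1 then a 0 * b 0 else if n = 2 then a 0 * b 1
     else if n = 3 then a 0 * b 2 - a 2 * b 0 else 0)"

definition seq_scale :: "'f::field \<Rightarrow> (nat \<Rightarrow> 'f) \<Rightarrow> nat \<Rightarrow> 'f" where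
  "seq_scale c a = (\<lambda>n. c * a n)"

text \<open>The basis element \<open>f\<^sub>i\<close>.\<close>

definition unit_seq :: "nat \<Rightarrow> nat \<Rightarrow> 'f::field" where
  "unit_seq i = (\<lambda>n. if n = i then 1 else 0)"

lemma vector_space_seq: "vector_space (seq_scale :: 'f::field \<Rightarrow> _)"
  by unfold_locales (auto simp: seq_scale_def algebra_simps)

lemma novikov_metabelian_seq:
  "novikov_metabelian (seq_scale :: 'f::field \<Rightarrow> _) seq_mul"
proof -
  interpret vector_space "seq_scale :: 'f \<Rightarrow> _"
    by (rule vector_space_seq)
  show ?thesis
    by unfold_locales
      (auto simp: seq_scale_def seq_mul_def associator_def fun_eq_iff algebra_simps)
qed

lemma unit_seq_in_left_power:
  assumes "m < 4"
  shows "unit_seq m \<in> left_power (seq_scale :: 'f::field \<Rightarrow> _) seq_mul (Suc m)"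
  using assms
proof (induction m)
  case 0
  show ?case by simp
next
  case (Suc m)
  interpret vector_space "seq_scale :: 'f \<Rightarrow> _"
    by (rule vector_space_seq)
  have "unit_seq (Suc m) = (seq_mul (unit_seq 0) (unit_seq m) :: nat \<Rightarrow> 'f)"
    using Suc.prems by (auto simp: unit_seq_def seq_mul_def fun_eq_iff)
  then show ?case
    using Suc by (auto intro!: span_base)
qed

lemma left_nilpotent_of_exact_index_5:
  fixes V :: "('f::field, 'a::ab_group_add) algebra_class"
    and W :: "('f, nat \<Rightarrow> 'f) algebra_class"
  assumes V: "\<And>scale mul. V scale mul \<Longrightarrow> weakly_novikov_metabelian scale mul"
    and W: "W seq_scale seq_mul"
  shows "left_nilpotent_of_exact_index V W 5"
proof -
  have "5 \<le> m" if m: "0 < m" and nil: "left_nilpotent_class W m" for m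
  proof (rule ccontr)
    assume "\<not> 5 \<le> m"
    with m obtain k where k: "m = Suc k" "k < 4"
      by (cases m) auto
    with nil W have "unit_seq k \<in> {0 :: nat \<Rightarrow> 'f}"
      using unit_seq_in_left_power[of k, where 'f = 'f] by (auto simp: left_nilpotent_class_def)
    then have "unit_seq k k = (0 :: 'f)"
      by simp
    then show False
      by (simp add: unit_seq_def)
  qed
  then show ?thesis
    by (simp add: left_nilpotent_of_exact_index_def)
      (simp add: left_nilpotent_class_def V weakly_novikov_metabelian.left_power_5)
qed

theorem mainTheorem2:
  assumes "CHAR('f::field) \<noteq> 2"
  shows "left_nilpotent_of_exact_index
           (weakly_novikov_metabelian :: ('f, 'a::ab_group_add) algebra_class)
           (weakly_novikov_metabelian :: ('f, nat \<Rightarrow> 'f) algebra_class) 5 \<and>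
         left_nilpotent_of_exact_index
           (novikov_metabelian :: ('f, 'a::ab_group_add) algebra_class)
           (novikov_metabelian :: ('f, nat \<Rightarrow> 'f) algebra_class) 5"
  using novikov_metabelian_seq[where 'f = 'f]
  by (auto intro!: left_nilpotent_of_exact_index_5 dest: novikov_metabelian.axioms(1))

end
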